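(* Let $0<\alpha<1$, let $A=\begin{bmatrix}\lambda_1&0\\0&\lambda_2\end{bmatrix}$ with $\lambda_1\neq\lambda_2$ real, let $c_1,c_2\in\mathbb{R}$ and $t_1>0$. Let $X$ be the solution of ${}_0^C\mathrm{D}_t^\alpha X(t)=AX(t)$ with $X(0)=(c_1,c_2)^T$, and let $Y$ be the solution of ${}_0^C\mathrm{D}_t^\alpha Y(t)=AY(t)$ with $Y(0)=X(t_1)$. Let $\nu_1,T_1,N_1,\kappa_1$ (respectively $\nu_2,T_2,N_2,\kappa_2$) be the speed, unit tangent, unit normal and curvature of the curve $X$ (respectively $Y$). Put $g_j(t)=\lambda_j t^{\alpha-1}E_{\alpha,\alpha}(\lambda_j t^\alpha)$, $e_j=E_\alpha(\lambda_j t_1^\alpha)$ for $j=1,2$, and $u_1=g_1\frac{dg_2}{dt}-g_2\frac{dg_1}{dt}$. Then for $t>0$, $$\nu_1(t)=\sqrt{c_1^2g_1(t)^2+c_2^2g_2(t)^2},\qquad \nu_2(t)=\sqrt{c_1^2e_1^2g_1(t)^2+c_2^2e_2^2g_2(t)^2},$$ and at every $t>0$ with $\nu_1(t)\neq0$ and $\nu_2(t)\neq 0$, $$\kappa_1=\left|\frac{c_1c_2u_1}{\nu_1^3}\right|,\qquad \kappa_2=\left|\frac{c_1c_2e_1e_2u_1}{\nu_2^3}\right|,\qquad \kappa_2=\left|\frac{e_1e_2\nu_1^3}{\nu_2^3}\right|\kappa_1,$$ $$T_1=\frac{(c_1g_1,\;c_2g_2)}{\nu_1},\qquad T_2=\frac{(c_1e_1g_1,\;c_2e_2g_2)}{\nu_2}=\frac{\nu_1}{\nu_2}\begin{bmatrix}e_1&0\\0&e_2\end{bmatrix}T_1,$$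 $$N_1=\frac{(-c_2g_2,\;c_1g_1)}{\nu_1},\qquad N_2=\frac{(-c_2e_2g_2,\;c_1e_1g_1)}{\nu_2}=\frac{\nu_1}{\nu_2}\begin{bmatrix}e_2&0\\0&e_1\end{bmatrix}N_1.$$ If instead $\lambda_1=\lambda_2=\lambda$ (all other data being as described), then $\nu_2(t)=E_\alpha(\lambda t_1^\alpha)\,\nu_1(t)$, and, at every $t>0$ with $\nu_1(t),\nu_2(t)\ne0$, $T_2=T_1$, $N_2=N_1$ and $\kappa_2=\kappa_1=0$.
   Context: The Caputo derivative of order $\alpha\in(0,1)$ is ${}_0^{C}\mathrm{D}_t^\alpha f(t)=\frac{1}{\Gamma(1-\alpha)}\int_0^t (t-\tau)^{-\alpha}f'(\tau)\,d\tau$ for $t>0$, applied componentwise. A solution of ${}_0^C\mathrm{D}_t^\alpha X=AX$ is a function continuous on $[0,\infty)$, continuously differentiable on $(0,\infty)$ with derivative integrable near $0$, satisfying the equation for all $t>0$. It is known that the solution with $X(0)=X_0$ is $X(t)=E_\alpha(At^\alpha)X_0$. The Mittag-Leffler functions are $E_\alpha(z)=\sum_{k=0}^\infty \frac{z^k}{\Gamma(\alpha k+1)}$ (also for matrix arguments) and $E_{\alpha,\beta}(z)=\sum_{k=0}^\infty\frac{z^k}{\Gamma(\alpha k+\beta)}$. For a planar curve $(x(t),y(t))$, twice differentiable for $t>0$, the speed is $\nu=\sqrt{\dot x^2+\dot y^2}$, and where $\nu\neq0$ the unit tangent is $T=(\dot x,\dot y)/\nu$, the unit normal is $N=(-\dot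 y,\dot x)/\nu$, and the curvature is taken unsigned: $\kappa=|\dot x\ddot y-\dot y\ddot x|/\nu^3$. Vectors are treated as columns when multiplied by matrices. *)

theory Defs
  imports "HOL-Analysis.Analysis"
begin

definition mittag_leffler2 :: "real \<Rightarrow> real \<Rightarrow> real \<Rightarrow> real" where
  "mittag_leffler2 \<alpha> \<beta> z = (\<Sum>k. z ^ k / Gamma (\<alpha> * real k + \<beta>))"

definition mittag_leffler :: "real \<Rightarrow> real \<Rightarrow> real" where
  "mittag_leffler \<alpha> z = (\<Sum>k. z ^ k / Gamma (\<alpha> * real k + 1))"

text \<open>The integral is the Lebesgue integral over the open interval, since the derivative
  need not exist at 0.\<close>

definition caputo_deriv :: "real \<Rightarrow> (real \<Rightarrow> real) \<Rightarrow> real \<Rightarrow> real" where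
  "caputo_deriv \<alpha> f t =
     1 / Gamma (1 - \<alpha>) * (LBINT \<tau>:{0<..<t}. (t - \<tau>) powr (-\<alpha>) * deriv f \<tau>)"

definition caputo_solution ::
  "real \<Rightarrow> real ^ 'n ^ 'n \<Rightarrow> real ^ 'n \<Rightarrow> (real \<Rightarrow> real ^ 'n) \<Rightarrow> bool" where
  "caputo_solution \<alpha> A X0 X \<longleftrightarrow>
     continuous_on {0..} X \<and>
     (\<forall>t>0. X differentiable (at t)) \<and>
     continuous_on {0<..} (\<lambda>t. vector_derivative X (at t)) \<and>
     (\<exists>\<delta>>0. set_integrable lborel {0<..<\<delta>} (\<lambda>t. vector_derivative X (at t))) \<and>
     (\<forall>t>0. (\<chi> i. caputo_deriv \<alpha> (\<lambda>s. X s $ i) t) = A *v X t) \<and>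
     X 0 = X0"

definition diag2 :: "real \<Rightarrow> real \<Rightarrow> real ^ 2 ^ 2" where
  "diag2 a b = vector [vector [a, 0], vector [0, b]]"

definition twice_differentiable_curve :: "(real \<Rightarrow> real ^ 2) \<Rightarrow> bool" where
  "twice_differentiable_curve X \<longleftrightarrow>
     (\<forall>i. \<forall>t>0. (\<lambda>s. X s $ i) differentiable (at t) \<and>
                deriv (\<lambda>s. X s $ i) differentiable (at t))"

definition curve_speed :: "(real \<Rightarrow> real ^ 2) \<Rightarrow> real \<Rightarrow> real" where
  "curve_speed X t = sqrt ((deriv (\<lambda>s. X s $ 1) t)\<^sup>2 + (deriv (\<lambda>s. X s $ 2) t)\<^sup>2)"

definition unit_tangent :: "(real \<Rightarrow> real ^ 2) \<Rightarrow> real \<Rightarrow> real ^ 2" where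
  "unit_tangent X t =
     (1 / curve_speed X t) *\<^sub>R vector [deriv (\<lambda>s. X s $ 1) t, deriv (\<lambda>s. X s $ 2) t]"

definition unit_normal :: "(real \<Rightarrow> real ^ 2) \<Rightarrow> real \<Rightarrow> real ^ 2" where
  "unit_normal X t =
     (1 / curve_speed X t) *\<^sub>R vector [- deriv (\<lambda>s. X s $ 2) t, deriv (\<lambda>s. X s $ 1) t]"

definition curvature :: "(real \<Rightarrow> real ^ 2) \<Rightarrow> real \<Rightarrow> real" where
  "curvature X t =
     \<bar>deriv (\<lambda>s. X s $ 1) t * deriv (deriv (\<lambda>s. X s $ 2)) t
       - deriv (\<lambda>s. X s $ 2) t * deriv (deriv (\<lambda>s. X s $ 1)) t\<bar> / curve_speed X t ^ 3"

end

theory Submission imports Defs begin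

text \<open>Each component of a solution is a scalar eigenfunction of the Caputo derivative. Applying the
  fractional integral of order \<open>\<alpha>\<close> (Fubini and the Beta integral) turns the equation into a Volterra
  equation, and iterating that equation compares the solution with the partial sums of
  \<open>x(0) E\<^sub>\<alpha>(\<lambda> t\<^sup>\<alpha>)\<close> up to a remainder that tends to zero. Termwise differentiation then yields all
  the formulas. For equal eigenvalues one also needs \<open>E\<^sub>\<alpha>(\<lambda> t\<^sup>\<alpha>) \<ge> 0\<close>; for \<open>\<lambda> < 0\<close> this is the extremum
  principle: at a minimum over \<open>[0, m]\<close> attained at \<open>m\<close> the Caputo derivative is nonpositive, so
  that \<open>\<lambda> x(m) \<le> 0\<close> excludes a negative minimum.\<close>

section \<open>Beta integrals and growth of Gamma\<close>

text \<open>The affine map from \<open>(u, t)\<close> onto \<open>(0, 1)\<close> reduces this to the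
  classical Beta integral. It serves with \<open>b = 1 - \<alpha>\<close> in the Fubini argument and
  with \<open>b = \<alpha> * real k + 1\<close> in the iteration.\<close>

lemma has_bochner_integral_Beta_kernel:
  fixes a b t u :: real
  assumes a: "0 < a" and b: "0 < b" and ut: "u < t"
  shows "has_bochner_integral lborel
    (\<lambda>s. indicator {u<..<t} s * ((t - s) powr (a - 1) * (s - u) powr (b - 1)))
    ((t - u) powr (a + b - 1) * Beta a b)"
proof -
  define f where "f = (\<lambda>x::real. indicator {0<..<1} x * (x powr (b - 1) * (1 - x) powr (a - 1)))"
  define d where "d = t - u"
  have d: "d > 0" using ut by (simp add: d_def)
  \<comment> \<open>This is a gauge integral; nonnegativity of the integrand makes it a Lebesgue
    integral.\<close>
  have "((\<lambda>x. x powr (b - 1) * (1 - x) powr (a - 1)) has_integral Beta b a) {0<..<1}"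
    using has_integral_Beta_real[OF b a] by (simp add: has_integral_Icc_iff_Ioo)
  from nn_integral_has_integral_lebesgue[OF _ this]
  have nn: "integral\<^sup>N lborel f = ennreal (Beta b a)"
    by (simp add: f_def)
  have "Beta b a \<ge> 0" unfolding Beta_def using a b by (simp add: Gamma_real_pos less_imp_le)
  then have "has_bochner_integral lborel f (Beta b a)"
    by (intro has_bochner_integral_nn_integral) (use nn in \<open>auto simp: f_def\<close>)
  then have "has_bochner_integral lborel (\<lambda>s. f (- u / d + 1 / d * s)) (Beta b a /\<^sub>R \<bar>1 / d\<bar>)"
    using lborel_has_bochner_integral_real_affine_iff[of "1 / d" f "Beta b a" "- u / d"] d by simp
  \<comment> \<open>Rescaling the two kernel factors costs \<open>d powr (a + b - 2)\<close>; the
    Jacobian contributes one more factor \<open>d\<close>.\<close>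
  then have *: "has_bochner_integral lborel (\<lambda>s. d powr (a + b - 2) * f (- u / d + 1 / d * s))
      (d powr (a + b - 2) * (Beta b a /\<^sub>R \<bar>1 / d\<bar>))"
    by (rule has_bochner_integral_mult_right)
  have eq: "d powr (a + b - 2) * f (- u / d + 1 / d * s) =
      indicator {u<..<t} s * ((t - s) powr (a - 1) * (s - u) powr (b - 1))" for s
  proof (cases "s \<in> {u<..<t}")
    case True
    have 1: "- u / d + 1 / d * s = (s - u) / d" by (simp add: diff_divide_distrib)
    have 2: "1 - (s - u) / d = (t - s) / d" using d by (simp add: d_def field_simps)
    have "d powr (a + b - 2) = d powr (b - 1) * d powr (a - 1)" 
      by (simp add: powr_add[symmetric] algebra_simps)
    moreover have "(s - u) / d \<in> {0<..<1}" using True d by (auto simp: d_def field_simps)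
    then have "f ((s - u) / d) = ((s - u) / d) powr (b - 1) * ((t - s) / d) powr (a - 1)"
      unfolding f_def 2 by simp
    ultimately show ?thesis unfolding 1 using True d
      by (simp add: powr_divide)
  next
    case False
    have 1: "- u / d + 1 / d * s = (s - u) / d" by (simp add: diff_divide_distrib)
    have "- u / d + 1 / d * s \<notin> {0<..<1}"
      unfolding 1 using False d by (auto simp: d_def zero_less_divide_iff divide_less_eq)
    then show ?thesis using False by (simp add: f_def)
  qed
  have "d powr (a + b - 1) = d powr (a + b - 2) * d"
    using powr_add[of d "a + b - 2" 1] d by simp
  then have val: "d powr (a + b - 2) * (Beta b a /\<^sub>R \<bar>1 / d\<bar>) = (t - u) powr (a + b - 1) * Beta a b"
    using d by (simp add: d_def Beta_commute)
  show ?thesis using * by (simp only: eq val)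
qed

text \<open>Log-convexity of Gamma gives this growth rate, which drives the ratio test for the
  Mittag-Leffler series.\<close>

lemma Gamma_add_ge:
  fixes x a :: real
  assumes a: "0 < a" and x: "1 < x"
  shows "(x - 1) powr a * Gamma x \<le> Gamma (x + a)"
proof -
  \<comment> \<open>compare the slopes of \<open>ln Gamma\<close> over \<open>[x - 1, x]\<close> and \<open>[x, x + a]\<close>\<close>
  have cv: "convex_on {0<..} (\<lambda>x::real. ln (Gamma x))"
    using log_convex_Gamma_real by (simp add: o_def)
  have "(ln (Gamma (x - 1)) - ln (Gamma (x + a))) / ((x - 1) - (x + a)) \<le> (ln (Gamma x) - ln (Gamma (x + a))) / (x - (x + a))"
    "(ln (Gamma (x - 1)) - ln (Gamma x)) / ((x - 1) - x) \<le> (ln (Gamma (x - 1)) - ln (Gamma (x + a))) / ((x - 1) - (x + a))"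
    using convex_on_slope_le[OF cv, of "x - 1" "x + a" x] a x by auto
  then have 1: "(ln (Gamma (x - 1)) - ln (Gamma x)) / ((x - 1) - x) \<le> (ln (Gamma x) - ln (Gamma (x + a))) / (x - (x + a))"
    by linarith
  \<comment> \<open>By the functional equation the slope over \<open>[x - 1, x]\<close> is exactly
    \<open>ln (x - 1)\<close>.\<close>
  have "Gamma x = (x - 1) * Gamma (x - 1)"
    using Gamma_plus1[of "x - 1"] x by (auto simp: nonpos_Ints_def)
  moreover have pos: "Gamma (x - 1) > 0" "Gamma x > 0" "Gamma (x + a) > 0"
    using x a by (auto intro!: Gamma_real_pos)
  ultimately have 2: "ln (Gamma x) = ln (x - 1) + ln (Gamma (x - 1))"
    using x ln_mult_pos[of "x - 1" "Gamma (x - 1)"] by simp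
  have "ln (x - 1) \<le> (ln (Gamma (x + a)) - ln (Gamma x)) / a"
    using 1 2 a by (simp add: field_simps)
  then have "a * ln (x - 1) + ln (Gamma x) \<le> ln (Gamma (x + a))"
    using a by (simp add: field_simps)
  then have "exp (a * ln (x - 1) + ln (Gamma x)) \<le> Gamma (x + a)"
    using pos by (metis exp_le_cancel_iff exp_ln)
  then show ?thesis using pos x by (simp add: exp_add powr_def)
qed

section \<open>Mittag-Leffler series and their derivatives\<close>

lemma summable_mittag_leffler2:
  fixes a b z :: real
  assumes a: "0 < a" and b: "0 < b"
  shows "summable (\<lambda>k. z ^ k / Gamma (a * real k + b))"
proof -
  \<comment> \<open>Chosen so that \<open>M powr a\<close> is at least
    \<open>2 * \<bar>z\<bar> + 1\<close>. Once the Gamma argument exceeds \<open>M + 1\<close>,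
    \<open>Gamma_add_ge\<close> bounds the ratio of consecutive terms by 1/2.\<close>
  define M where "M = max 1 ((2 * \<bar>z\<bar> + 1) powr (1 / a))"
  obtain N :: nat where N: "(M + 1) / a \<le> real N" using real_arch_simple by blast
  have large: "a * real k + b - 1 \<ge> M" if "k \<ge> N" for k
  proof -
    have "M + 1 \<le> a * real N" using N a by (simp add: field_simps)
    also have "\<dots> \<le> a * real k" using that a by simp
    finally show ?thesis using b by simp
  qed
  show ?thesis
  proof (rule summable_ratio_test[of "1/2" N])
    fix k assume k: "N \<le> k"
    define y where "y = a * real k + b"
    have y: "y > 1" using large[OF k] by (auto simp: y_def M_def)
    have p: "Gamma y > 0" "Gamma (y + a) > 0" using y a by (auto intro!: Gamma_real_pos)
    have "2 * \<bar>z\<bar> + 1 = ((2 * \<bar>z\<bar> + 1) powr (1 / a)) powr a"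
      using a by (simp add: powr_powr)
    also have "\<dots> \<le> (y - 1) powr a"
      using large[OF k] a by (intro powr_mono2) (auto simp: y_def M_def)
    finally have "(2 * \<bar>z\<bar>) * Gamma y \<le> (y - 1) powr a * Gamma y"
      using p by (intro mult_right_mono) auto
    also have "\<dots> \<le> Gamma (y + a)" by (rule Gamma_add_ge[OF a y])
    finally have *: "2 * \<bar>z\<bar> / Gamma (y + a) \<le> 1 / Gamma y" using p by (simp add: field_simps)
    have "norm (z ^ Suc k / Gamma (a * real (Suc k) + b)) = \<bar>z\<bar> ^ k / 2 * (2 * \<bar>z\<bar> / Gamma (y + a))"
      using p by (simp add: y_def abs_mult power_abs algebra_simps)
    also have "\<dots> \<le> \<bar>z\<bar> ^ k / 2 * (1 / Gamma y)"
      by (intro mult_left_mono *) auto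
    also have "\<dots> = 1 / 2 * norm (z ^ k / Gamma (a * real k + b))"
      using p by (simp add: y_def[symmetric] power_abs)
    finally show "norm (z ^ Suc k / Gamma (a * real (Suc k) + b)) \<le> 1 / 2 * norm (z ^ k / Gamma (a * real k + b))" .
  qed simp
qed

text \<open>The derivative stays a raw \<open>diffs\<close> series: it is identified only for
  \<open>b = 1\<close>, while for \<open>b = a\<close> its existence suffices.\<close>

lemma has_field_derivative_mittag_leffler2:
  assumes "0 < a" and "0 < b"
  shows "(mittag_leffler2 a b has_field_derivative
    (\<Sum>k. diffs (\<lambda>k. 1 / Gamma (a * real k + b)) k * z ^ k)) (at z)"
  using termdiffs_strong_converges_everywhere[of "\<lambda>k. 1 / Gamma (a * real k + b)" z]
    summable_mittag_leffler2[OF assms]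
  by (simp add: mittag_leffler2_def[abs_def])

lemma mittag_leffler_eq: "mittag_leffler a = mittag_leffler2 a 1"
  by (simp add: mittag_leffler_def mittag_leffler2_def fun_eq_iff)

text \<open>In the termwise derivative, the factor \<open>k + 1\<close> cancels against
  \<open>Gamma (a * (k + 1) + 1)\<close> by the functional equation, leaving \<open>1 / a\<close>
  and the coefficients of parameter \<open>a\<close>.\<close>

lemma has_field_derivative_mittag_leffler:
  assumes a: "0 < a"
  shows "(mittag_leffler a has_field_derivative mittag_leffler2 a a z / a) (at z)"
proof -
  have "diffs (\<lambda>k. 1 / Gamma (a * real k + 1)) k * z ^ k = z ^ k / Gamma (a * real k + a) / a" for k
  proof -
    have "a * real (Suc k) > 0" using a by simp
    then have "a * real (Suc k) \<notin> \<int>\<^sub>\<le>\<^sub>0" by (meson nonpos_Ints_nonpos not_le)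
    then have "Gamma (a * real (Suc k) + 1) = a * real (Suc k) * Gamma (a * real k + a)"
      using Gamma_plus1[of "a * real (Suc k)"] by (simp add: algebra_simps)
    then show ?thesis using a by (simp add: diffs_def)
  qed
  then have "(\<Sum>k. diffs (\<lambda>k. 1 / Gamma (a * real k + 1)) k * z ^ k) = mittag_leffler2 a a z / a"
    unfolding mittag_leffler2_def
    using suminf_divide[OF summable_mittag_leffler2[OF a a, of z], of a] by simp
  then show ?thesis
    using has_field_derivative_mittag_leffler2[OF a zero_less_one, of z] by (simp add: mittag_leffler_eq)
qed

text \<open>The inner derivative \<open>l * a * t powr (a - 1)\<close> cancels the factor
  \<open>1 / a\<close>; the result is the function called \<open>g1\<close> or \<open>g2\<close> in
  the theorem.\<close>

lemma has_field_derivative_mittag_leffler_powr: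
  assumes a: "0 < a" and t: "0 < t"
  shows "((\<lambda>t. mittag_leffler a (l * t powr a)) has_field_derivative
    l * t powr (a - 1) * mittag_leffler2 a a (l * t powr a)) (at t)"
  by (rule has_field_derivative_mittag_leffler[OF a, THEN DERIV_chain2, THEN DERIV_cong])
    (use a t in \<open>auto intro!: derivative_eq_intros\<close>)

lemma mittag_leffler2_powr_differentiable:
  assumes a: "0 < a" and t: "0 < (t::real)"
  shows "(\<lambda>t. l * t powr (a - 1) * mittag_leffler2 a a (l * t powr a)) differentiable (at t)"
proof -
  have "((\<lambda>t. l * t powr a) has_field_derivative l * (a * t powr (a - 1))) (at t)"
    using t by (auto intro!: derivative_eq_intros)
  note DERIV_chain2[OF has_field_derivative_mittag_leffler2[OF a a] this]
  then have "(\<lambda>t. mittag_leffler2 a a (l * t powr a)) differentiable (at t)"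
    by (auto simp: real_differentiable_def)
  moreover have "(\<lambda>t. t powr (a - 1)) differentiable (at t)"
    unfolding real_differentiable_def using t
    by (intro exI) (rule has_real_derivative_powr)
  ultimately show ?thesis by (intro differentiable_mult) auto
qed

section \<open>Scalar Caputo eigenfunctions: Volterra equation and series representation\<close>

text \<open>A diagonal system decouples, so each component is treated alone. The value
  \<open>x 0\<close> stays free, so that the components of both \<open>X\<close> and
  \<open>Y\<close> are instances.\<close>

locale caputo_eigenfunction =
  fixes \<alpha> l :: real and x :: "real \<Rightarrow> real"
  assumes \<alpha>: "0 < \<alpha>" "\<alpha> < 1"
    and cont: "continuous_on {0..} x"
    and diff: "\<And>t. t > 0 \<Longrightarrow> x differentiable (at t)"
    and cont_deriv: "continuous_on {0<..} (deriv x)"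
    and int_deriv: "\<exists>\<delta>>0. set_integrable lborel {0<..<\<delta>} (deriv x)"
    and caputo: "\<And>t. t > 0 \<Longrightarrow> caputo_deriv \<alpha> x t = l * x t"
begin

lemma DERIV: "t > 0 \<Longrightarrow> (x has_field_derivative deriv x t) (at t)"
  using diff DERIV_deriv_iff_real_differentiable by blast

text \<open>Integrability near 0 is glued to continuity on the compact interval
  \<open>{d/2..t}\<close>, which overlaps \<open>{0<..<d}\<close>.\<close>

lemma set_integrable_deriv:
  assumes "t > 0"
  shows "set_integrable lborel {0<..<t} (deriv x)"
proof -
  obtain d where d: "d > 0" "set_integrable lborel {0<..<d} (deriv x)"
    using int_deriv by blast
  have "set_integrable lborel {d/2..t} (deriv x)"
    by (intro borel_integrable_atLeastAtMost' continuous_on_subset[OF cont_deriv]) (use d in auto)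
  with d have "set_integrable lborel ({0<..<d} \<union> {d/2..t}) (deriv x)"
    by (intro set_integrable_Un) auto
  then show ?thesis
    by (rule set_integrable_subset) (use d in auto)
qed

text \<open>The interior form of the fundamental theorem tolerates a derivative that need not exist
  at 0; integrability of \<open>deriv x\<close> then identifies gauge and Lebesgue integral.\<close>

lemma integral_deriv:
  assumes "t > 0"
  shows "(LBINT \<tau>:{0<..<t}. deriv x \<tau>) = x t - x 0"
proof -
  have "(deriv x has_integral (x t - x 0)) {0..t}"
    by (intro fundamental_theorem_of_calculus_interior continuous_on_subset[OF cont])
      (use assms DERIV in \<open>auto simp: has_real_derivative_iff_has_vector_derivative\<close>)
  then have "integral {0<..<t} (deriv x) = x t - x 0"
    by (simp add: has_integral_Icc_iff_Ioo integral_unique)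
  then show ?thesis
    using set_borel_integral_eq_integral(2)[OF set_integrable_deriv[OF assms]] by simp
qed

text \<open>Integrate the equation at \<open>s\<close> against
  \<open>(t - s) powr (\<alpha> - 1)\<close> and swap the order of integration: the inner kernel has
  constant mass, so only the integral of \<open>deriv x\<close> remains.\<close>

lemma volterra:
  assumes t: "t > 0"
  shows "x t = x 0 + l / Gamma \<alpha> * (LBINT s:{0<..<t}. (t - s) powr (\<alpha> - 1) * x s)"
proof -
  define d where "d = (\<lambda>\<tau>. indicator {0<..<t} \<tau> * deriv x \<tau>)"
  define K where "K = (\<lambda>\<tau> s. indicator {\<tau><..<t} s * ((t - s) powr (\<alpha> - 1) * (s - \<tau>) powr ((1 - \<alpha>) - 1)))"
  define B where "B = Beta \<alpha> (1 - \<alpha>)"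
  have "set_borel_measurable borel {0<..<t} (deriv x)"
    unfolding set_borel_measurable_def
    by (intro borel_measurable_continuous_on_indicator continuous_on_subset[OF cont_deriv]) auto
  then have d_meas [measurable]: "d \<in> borel_measurable borel"
    by (simp add: set_borel_measurable_def d_def)
  have d_int: "integrable lborel d"
    using set_integrable_deriv[OF t] by (simp add: set_integrable_def d_def)
  \<comment> \<open>The exponents add up to \<open>\<alpha> + (1 - \<alpha>) - 1 = 0\<close>, so the
    mass \<open>B\<close> does not depend on \<open>\<tau>\<close>.\<close>
  have K: "has_bochner_integral lborel (K \<tau>) B" if "\<tau> < t" for \<tau>
    using has_bochner_integral_Beta_kernel[of \<alpha> "1 - \<alpha>" \<tau> t] \<alpha> that by (simp add: K_def B_def)
  have dK: "has_bochner_integral lborel (\<lambda>s. d \<tau> * K \<tau> s) (d \<tau> * B)" for \<tau>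
  proof (cases "\<tau> < t")
    case True
    then show ?thesis by (intro has_bochner_integral_mult_right K)
  next
    case False
    then show ?thesis by (simp add: d_def has_bochner_integral_zero)
  qed
  have K_nonneg: "K \<tau> s \<ge> 0" for \<tau> s by (simp add: K_def)
  \<comment> \<open>Absolute integrability for Fubini: \<open>K\<close> is nonnegative, so
    integrating the norm over \<open>s\<close> gives \<open>\<bar>d \<tau> * B\<bar>\<close>, which
    is integrable in \<open>\<tau>\<close>.\<close>
  have "integrable (lborel \<Otimes>\<^sub>M lborel) (\<lambda>(\<tau>, s). d \<tau> * K \<tau> s)"
  proof (rule lborel_pair.Fubini_integrable)
    have [measurable]: "(\<lambda>p. indicator {fst p<..<t} (snd p) :: real) \<in> borel_measurable (lborel \<Otimes>\<^sub>M lborel)"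
      unfolding indicator_def greaterThanLessThan_iff by measurable
    show "(\<lambda>(\<tau>, s). d \<tau> * K \<tau> s) \<in> borel_measurable (lborel \<Otimes>\<^sub>M lborel)"
      unfolding K_def case_prod_beta by measurable
    have "(\<lambda>\<tau>. \<integral>s. norm (d \<tau> * K \<tau> s) \<partial>lborel) = (\<lambda>\<tau>. \<bar>d \<tau> * B\<bar>)"
    proof
      fix \<tau>
      show "(\<integral>s. norm (d \<tau> * K \<tau> s) \<partial>lborel) = \<bar>d \<tau> * B\<bar>"
      proof (cases "\<tau> < t")
        case True
        then have "0 \<le> B"
          using K[THEN has_bochner_integral_integral_eq] integral_nonneg_AE[of "K \<tau>" lborel] K_nonneg by auto
        then show ?thesis
          using K[OF True, THEN has_bochner_integral_integral_eq] K_nonneg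
          by (simp add: abs_mult)
      qed (simp add: d_def)
    qed
    then show "integrable lborel (\<lambda>\<tau>. \<integral>s. norm (case (\<tau>, s) of (\<tau>, s) \<Rightarrow> d \<tau> * K \<tau> s) \<partial>lborel)"
      using d_int by (simp add: integrable_abs)
    show "AE \<tau> in lborel. integrable lborel (\<lambda>s. case (\<tau>, s) of (\<tau>, s) \<Rightarrow> d \<tau> * K \<tau> s)"
      using dK by (auto simp: has_bochner_integral_iff)
  qed
  from lborel_pair.Fubini_integral[OF this]
  have "(\<integral>s. (\<integral>\<tau>. d \<tau> * K \<tau> s \<partial>lborel) \<partial>lborel) = (\<integral>\<tau>. (\<integral>s. d \<tau> * K \<tau> s \<partial>lborel) \<partial>lborel)" .
  also have "\<dots> = (\<integral>\<tau>. d \<tau> \<partial>lborel) * B"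
    by (simp only: dK[THEN has_bochner_integral_integral_eq] Bochner_Integration.integral_mult_left_zero)
  also have "(\<integral>\<tau>. d \<tau> \<partial>lborel) = x t - x 0"
    using integral_deriv[OF t] by (simp add: d_def set_lebesgue_integral_def)
  \<comment> \<open>For fixed \<open>s\<close> the inner integral contains the Caputo integral up to
    \<open>s\<close>, which the equation replaces. This is an identity for every \<open>s\<close>:
    if the integrand is not integrable, the same default value occurs on both sides.\<close>
  also have "(\<lambda>s. \<integral>\<tau>. d \<tau> * K \<tau> s \<partial>lborel) =
      (\<lambda>s. Gamma (1 - \<alpha>) * l * (indicator {0<..<t} s * ((t - s) powr (\<alpha> - 1) * x s)))"
  proof
    fix s
    show "(\<integral>\<tau>. d \<tau> * K \<tau> s \<partial>lborel) = Gamma (1 - \<alpha>) * l * (indicator {0<..<t} s * ((t - s) powr (\<alpha> - 1) * x s))"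
    proof (cases "s \<in> {0<..<t}")
      case True
      have "(\<lambda>\<tau>. d \<tau> * K \<tau> s) = (\<lambda>\<tau>. (t - s) powr (\<alpha> - 1) * (indicator {0<..<s} \<tau> * ((s - \<tau>) powr (- \<alpha>) * deriv x \<tau>)))"
        using True by (auto simp: d_def K_def indicator_def fun_eq_iff)
      moreover have "Gamma (1 - \<alpha>) > 0" using \<alpha> by (intro Gamma_real_pos) auto
      then have "(\<integral>\<tau>. indicator {0<..<s} \<tau> * ((s - \<tau>) powr (- \<alpha>) * deriv x \<tau>) \<partial>lborel) = Gamma (1 - \<alpha>) * l * x s"
        using caputo[of s] True by (simp add: caputo_deriv_def set_lebesgue_integral_def field_simps)
      ultimately show ?thesis using True by simp
    next
      case False
      then have "(\<lambda>\<tau>. d \<tau> * K \<tau> s) = (\<lambda>\<tau>. 0)"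
        by (auto simp: d_def K_def indicator_def fun_eq_iff)
      then show ?thesis using False by simp
    qed
  qed
  also have "(\<integral>s. Gamma (1 - \<alpha>) * l * (indicator {0<..<t} s * ((t - s) powr (\<alpha> - 1) * x s)) \<partial>lborel) =
      Gamma (1 - \<alpha>) * l * (LBINT s:{0<..<t}. (t - s) powr (\<alpha> - 1) * x s)"
    by (simp add: set_lebesgue_integral_def)
  also have "B = Gamma \<alpha> * Gamma (1 - \<alpha>)" by (simp add: B_def Beta_def)
  finally have "Gamma (1 - \<alpha>) * (l * (LBINT s:{0<..<t}. (t - s) powr (\<alpha> - 1) * x s)) =
      Gamma (1 - \<alpha>) * ((x t - x 0) * Gamma \<alpha>)"
    by (simp only: mult_ac)
  moreover have "Gamma (1 - \<alpha>) > 0" "Gamma \<alpha> > 0" using \<alpha> by (auto intro!: Gamma_real_pos)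
  ultimately have "l * (LBINT s:{0<..<t}. (t - s) powr (\<alpha> - 1) * x s) = (x t - x 0) * Gamma \<alpha>"
    and "Gamma \<alpha> > 0"
    by simp_all
  then show ?thesis by (simp add: field_simps)
qed

text \<open>Restricted to \<open>t > 0\<close>, because \<open>0 powr 0 = 0\<close> spoils the term \<open>k = 0\<close>.\<close>

lemma partial_sum_bound:
  assumes M: "\<And>s. 0 < s \<Longrightarrow> s \<le> T \<Longrightarrow> \<bar>x s\<bar> \<le> M" and t: "0 < t" "t \<le> T"
  shows "\<bar>x t - x 0 * (\<Sum>k<n. l ^ k * t powr (\<alpha> * real k) / Gamma (\<alpha> * real k + 1))\<bar>
    \<le> M * (\<bar>l\<bar> ^ n * t powr (\<alpha> * real n) / Gamma (\<alpha> * real n + 1))"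
  using t
proof (induction n arbitrary: t)
  case 0
  then show ?case using M by simp
next
  case (Suc n)
  define S where "S = (\<lambda>t. \<Sum>k<n. l ^ k * t powr (\<alpha> * real k) / Gamma (\<alpha> * real k + 1))"
  define k\<alpha> where "k\<alpha> = (\<lambda>s. indicator {0<..<t} s * (t - s) powr (\<alpha> - 1))"
  have Gpos: "Gamma (\<alpha> * real k + 1) > 0" "Gamma \<alpha> > 0" for k
    using \<alpha> by (auto intro!: Gamma_real_pos add_nonneg_pos)
  \<comment> \<open>The fractional integral sends the \<open>k\<close>-th normalised power to the
    next one; \<open>Gamma \<alpha>\<close> will cancel the prefactor in
    \<open>volterra\<close>.\<close>
  have J: "has_bochner_integral lborel (\<lambda>s. k\<alpha> s * (s powr (\<alpha> * real k) / Gamma (\<alpha> * real k + 1)))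
      (Gamma \<alpha> * (t powr (\<alpha> * real (Suc k)) / Gamma (\<alpha> * real (Suc k) + 1)))" for k
  proof -
    have "has_bochner_integral lborel
      (\<lambda>s. indicator {0<..<t} s * ((t - s) powr (\<alpha> - 1) * (s - 0) powr ((\<alpha> * real k + 1) - 1)) / Gamma (\<alpha> * real k + 1))
      ((t - 0) powr (\<alpha> + (\<alpha> * real k + 1) - 1) * Beta \<alpha> (\<alpha> * real k + 1) / Gamma (\<alpha> * real k + 1))"
      using \<alpha> Suc.prems by (intro has_bochner_integral_divide_zero has_bochner_integral_Beta_kernel) (auto intro: add_nonneg_pos)
    then show ?thesis
      using Gpos(1)[of k] by (simp add: k\<alpha>_def Beta_def algebra_simps)
  qed
  have JS: "has_bochner_integral lborel (\<lambda>s. k\<alpha> s * S s)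
      (\<Sum>k<n. l ^ k * (Gamma \<alpha> * (t powr (\<alpha> * real (Suc k)) / Gamma (\<alpha> * real (Suc k) + 1))))"
  proof -
    have "(\<lambda>s. k\<alpha> s * S s) = (\<lambda>s. \<Sum>k<n. l ^ k * (k\<alpha> s * (s powr (\<alpha> * real k) / Gamma (\<alpha> * real k + 1))))"
      by (simp add: S_def sum_distrib_left algebra_simps)
    then show ?thesis
      by (simp only:) (intro has_bochner_integral_sum has_bochner_integral_mult_right J)
  qed
  have k_meas [measurable]: "k\<alpha> \<in> borel_measurable borel" by (simp add: k\<alpha>_def)
  have k_int: "integrable lborel k\<alpha>"
  proof -
    \<comment> \<open>The factor \<open>(s - 0) powr (1 - 1)\<close> is 1 on the support and
      exhibits the kernel as a Beta kernel with \<open>b = 1\<close>.\<close>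
    have "k\<alpha> = (\<lambda>s. indicator {0<..<t} s * ((t - s) powr (\<alpha> - 1) * (s - 0) powr (1 - 1)))"
      by (auto simp: fun_eq_iff k\<alpha>_def indicator_def)
    then show ?thesis
      using has_bochner_integral_Beta_kernel[of \<alpha> 1 0 t] \<alpha> Suc.prems
      by (simp add: has_bochner_integral_iff)
  qed
  \<comment> \<open>Nothing is known about \<open>x\<close> on the negative axis, so measurability
    is available only after cutting off.\<close>
  have x_meas [measurable]: "(\<lambda>s. indicator {0<..<t} s * x s) \<in> borel_measurable borel"
  proof -
    have "continuous_on {0<..<t} x" by (rule continuous_on_subset[OF cont]) auto
    then show ?thesis using borel_measurable_continuous_on_indicator[of "{0<..<t}" x] by simp
  qed
  have kx_eq: "k\<alpha> s * x s = k\<alpha> s * (indicator {0<..<t} s * x s)" for s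
    by (simp add: k\<alpha>_def indicator_def)
  have kx_int: "integrable lborel (\<lambda>s. k\<alpha> s * x s)"
  proof (rule Bochner_Integration.integrable_bound)
    show "integrable lborel (\<lambda>s. M * k\<alpha> s)" using k_int by simp
    show "(\<lambda>s. k\<alpha> s * x s) \<in> borel_measurable lborel"
      unfolding kx_eq by measurable
    show "AE s in lborel. norm (k\<alpha> s * x s) \<le> norm (M * k\<alpha> s)"
    proof (rule AE_I2)
      fix s
      show "norm (k\<alpha> s * x s) \<le> norm (M * k\<alpha> s)"
        using M[of s] Suc.prems
        by (cases "s \<in> {0<..<t}") (auto simp: k\<alpha>_def abs_mult mult.commute intro!: mult_right_mono)
    qed
  qed
  define I where "I = (\<integral>s. k\<alpha> s * (x s - x 0 * S s) \<partial>lborel)"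
  have I_eq: "I = (\<integral>s. k\<alpha> s * x s \<partial>lborel) - x 0 * (\<Sum>k<n. l ^ k * (Gamma \<alpha> * (t powr (\<alpha> * real (Suc k)) / Gamma (\<alpha> * real (Suc k) + 1))))"
  proof -
    have "I = (\<integral>s. k\<alpha> s * x s - x 0 * (k\<alpha> s * S s) \<partial>lborel)"
      by (simp add: I_def algebra_simps)
    also have "\<dots> = (\<integral>s. k\<alpha> s * x s \<partial>lborel) - x 0 * (\<integral>s. k\<alpha> s * S s \<partial>lborel)"
      using kx_int JS by (subst Bochner_Integration.integral_diff) (auto simp: has_bochner_integral_iff)
    finally show ?thesis using JS by (simp add: has_bochner_integral_iff)
  qed
  \<comment> \<open>By \<open>volterra\<close>, the remainder after \<open>Suc n\<close> terms is
    the fractional integral of the remainder after \<open>n\<close> terms, times \<open>l\<close>.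
    The term \<open>k = 0\<close> of the shifted sum accounts for \<open>x 0\<close>.\<close>
  have step: "x t - x 0 * (\<Sum>k<Suc n. l ^ k * t powr (\<alpha> * real k) / Gamma (\<alpha> * real k + 1)) = l / Gamma \<alpha> * I"
  proof -
    have "(\<integral>s. k\<alpha> s * x s \<partial>lborel) = (LBINT s:{0<..<t}. (t - s) powr (\<alpha> - 1) * x s)"
      by (simp add: k\<alpha>_def set_lebesgue_integral_def mult.assoc)
    then have "x t = x 0 + l / Gamma \<alpha> * (\<integral>s. k\<alpha> s * x s \<partial>lborel)"
      using volterra[OF Suc.prems(1)] by simp
    moreover have "(\<Sum>k<Suc n. l ^ k * t powr (\<alpha> * real k) / Gamma (\<alpha> * real k + 1)) =
        1 + l / Gamma \<alpha> * (\<Sum>k<n. l ^ k * (Gamma \<alpha> * (t powr (\<alpha> * real (Suc k)) / Gamma (\<alpha> * real (Suc k) + 1))))"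
      using Gpos(2) Suc.prems by (subst sum.lessThan_Suc_shift) (simp add: sum_distrib_left mult.assoc)
    ultimately show ?thesis unfolding I_eq by (simp add: algebra_simps)
  qed
  \<comment> \<open>The induction hypothesis is integrated against the nonnegative kernel;
    \<open>J\<close> at \<open>k = n\<close> then evaluates the bound.\<close>
  have "\<bar>I\<bar> \<le> (\<integral>s. M * \<bar>l\<bar> ^ n * (k\<alpha> s * (s powr (\<alpha> * real n) / Gamma (\<alpha> * real n + 1))) \<partial>lborel)"
    unfolding I_def
  proof (rule order_trans[OF integral_abs_bound], rule integral_mono)
    show "integrable lborel (\<lambda>s. \<bar>k\<alpha> s * (x s - x 0 * S s)\<bar>)"
      using kx_int JS
      by (intro integrable_abs) (auto simp: right_diff_distrib mult.left_commute[of "k\<alpha> _" "x 0"] has_bochner_integral_iff)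
    show "integrable lborel (\<lambda>s. M * \<bar>l\<bar> ^ n * (k\<alpha> s * (s powr (\<alpha> * real n) / Gamma (\<alpha> * real n + 1))))"
      by (rule integrable.intros[OF has_bochner_integral_mult_right[OF J]])
    fix s :: real
    show "\<bar>k\<alpha> s * (x s - x 0 * S s)\<bar> \<le> M * \<bar>l\<bar> ^ n * (k\<alpha> s * (s powr (\<alpha> * real n) / Gamma (\<alpha> * real n + 1)))"
    proof (cases "s \<in> {0<..<t}")
      case True
      then have "\<bar>x s - x 0 * S s\<bar> \<le> M * (\<bar>l\<bar> ^ n * s powr (\<alpha> * real n) / Gamma (\<alpha> * real n + 1))"
        unfolding S_def using Suc.prems by (intro Suc.IH) auto
      then have "k\<alpha> s * \<bar>x s - x 0 * S s\<bar> \<le> k\<alpha> s * (M * (\<bar>l\<bar> ^ n * s powr (\<alpha> * real n) / Gamma (\<alpha> * real n + 1)))"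
        by (rule mult_left_mono) (simp add: k\<alpha>_def)
      moreover have "\<bar>k\<alpha> s\<bar> = k\<alpha> s" by (simp add: k\<alpha>_def)
      ultimately show ?thesis by (simp add: abs_mult mult_ac)
    qed (simp add: k\<alpha>_def)
  qed
  also have "\<dots> = M * \<bar>l\<bar> ^ n * (Gamma \<alpha> * (t powr (\<alpha> * real (Suc n)) / Gamma (\<alpha> * real (Suc n) + 1)))"
    by (rule has_bochner_integral_integral_eq[OF has_bochner_integral_mult_right[OF J]])
  finally have "\<bar>l\<bar> / Gamma \<alpha> * \<bar>I\<bar> \<le> \<bar>l\<bar> / Gamma \<alpha> * (M * \<bar>l\<bar> ^ n * (Gamma \<alpha> * (t powr (\<alpha> * real (Suc n)) / Gamma (\<alpha> * real (Suc n) + 1))))"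
    using Gpos(2) by (intro mult_left_mono) auto
  then show ?case unfolding step using Gpos(2) by (simp add: abs_mult mult_ac)
qed

text \<open>The bound in \<open>partial_sum_bound\<close> is \<open>M\<close> times the general term
  of the convergent series at \<open>\<bar>l\<bar> * t powr \<alpha>\<close>, so it tends to
  0.\<close>

lemma eq_mittag_leffler:
  assumes t: "t > 0"
  shows "x t = x 0 * mittag_leffler \<alpha> (l * t powr \<alpha>)"
proof -
  have "compact (x ` {0..t})"
    by (intro compact_continuous_image continuous_on_subset[OF cont]) auto
  then obtain M where "\<forall>y\<in>x ` {0..t}. norm y \<le> M"
    using compact_imp_bounded bounded_iff by blast
  then have M: "\<And>s. 0 < s \<Longrightarrow> s \<le> t \<Longrightarrow> \<bar>x s\<bar> \<le> M" by simp
  have pw: "(l' * t powr \<alpha>) ^ k = l' ^ k * t powr (\<alpha> * real k)" for k l'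
    using t by (simp add: power_mult_distrib powr_power mult.commute)
  have sm: "summable (\<lambda>k. (l' * t powr \<alpha>) ^ k / Gamma (\<alpha> * real k + 1))" for l'
    using \<alpha> by (intro summable_mittag_leffler2) auto
  have "(\<lambda>n. \<Sum>k<n. (l * t powr \<alpha>) ^ k / Gamma (\<alpha> * real k + 1)) \<longlonglongrightarrow> mittag_leffler \<alpha> (l * t powr \<alpha>)"
    unfolding mittag_leffler_def by (rule summable_LIMSEQ[OF sm])
  then have 1: "(\<lambda>n. \<bar>x t - x 0 * (\<Sum>k<n. l ^ k * t powr (\<alpha> * real k) / Gamma (\<alpha> * real k + 1))\<bar>)
      \<longlonglongrightarrow> \<bar>x t - x 0 * mittag_leffler \<alpha> (l * t powr \<alpha>)\<bar>"
    unfolding pw by (intro tendsto_intros)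
  have 2: "(\<lambda>n. M * (\<bar>l\<bar> ^ n * t powr (\<alpha> * real n) / Gamma (\<alpha> * real n + 1))) \<longlonglongrightarrow> M * 0"
    using summable_LIMSEQ_zero[OF sm[of "\<bar>l\<bar>"]] unfolding pw by (intro tendsto_intros)
  have "\<bar>x t - x 0 * mittag_leffler \<alpha> (l * t powr \<alpha>)\<bar> \<le> M * 0"
    by (rule LIMSEQ_le[OF 1 2]) (use partial_sum_bound[of t M t] M t in auto)
  then show ?thesis by simp
qed


section \<open>Extremum principle and sign of the Mittag-Leffler function\<close>

text \<open>Integration by parts: the derivative of \<open>F\<close> is \<open>a * \<phi>\<close>
  plus a term that is nonnegative because \<open>h\<close> is. Hence truncated integrals of
  \<open>a * \<phi>\<close> are at most \<open>F (m - \<epsilon> n)\<close>, which tends to 0. The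
  factor \<open>a\<close> treats minima and maxima of \<open>x\<close> together.\<close>

lemma caputo_integral_nonpos_at_min:
  fixes a m :: real
  assumes m: "0 < m" and min: "\<And>s. 0 \<le> s \<Longrightarrow> s \<le> m \<Longrightarrow> a * x m \<le> a * x s"
    and int: "set_integrable lborel {0<..<m} (\<lambda>\<tau>. (m - \<tau>) powr (- \<alpha>) * deriv x \<tau>)"
  shows "a * (LBINT \<tau>:{0<..<m}. (m - \<tau>) powr (- \<alpha>) * deriv x \<tau>) \<le> 0"
proof -
  define h where "h = (\<lambda>\<tau>. a * x \<tau> - a * x m)"
  define F where "F = (\<lambda>\<tau>. (m - \<tau>) powr (- \<alpha>) * h \<tau>)"
  define \<phi> where "\<phi> = (\<lambda>\<tau>. (m - \<tau>) powr (- \<alpha>) * deriv x \<tau>)"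
  \<comment> \<open>The offset 3 keeps \<open>\<epsilon> n\<close> at most \<open>m / 3\<close>, so
    every truncated interval \<open>{\<epsilon> n..m - \<epsilon> n}\<close> is nonempty.\<close>
  define \<epsilon> where "\<epsilon> = (\<lambda>n. m / (3 + real n))"
  have \<epsilon>: "0 < \<epsilon> n" "\<epsilon> n \<le> m / 3" for n
    using m by (auto simp: \<epsilon>_def field_simps)
  have \<epsilon>_lim: "\<epsilon> \<longlonglongrightarrow> 0"
    unfolding \<epsilon>_def by (intro tendsto_divide_0[OF tendsto_const] filterlim_at_top_imp_at_infinity
      filterlim_tendsto_add_at_top[OF tendsto_const] filterlim_real_sequentially)
  have le: "a * (LBINT \<tau>:{\<epsilon> n..m - \<epsilon> n}. \<phi> \<tau>) \<le> F (m - \<epsilon> n)" for n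
  proof -
    define p where "p = \<epsilon> n"
    have p: "0 < p" "p \<le> m / 3" using \<epsilon>[of n] by (auto simp: p_def)
    define F' where "F' = (\<lambda>\<tau>. a * \<phi> \<tau> + \<alpha> * (m - \<tau>) powr (- \<alpha> - 1) * h \<tau>)"
    have DF: "(F has_field_derivative F' \<tau>) (at \<tau>)" if "0 < \<tau>" "\<tau> < m" for \<tau>
      unfolding F_def F'_def h_def \<phi>_def
      by (rule DERIV_cong, (rule derivative_eq_intros DERIV refl | use that in simp)+)
    have F'int: "(F' has_integral (F (m - p) - F p)) {p..m - p}"
      using p m DF
      by (intro fundamental_theorem_of_calculus)
        (auto simp flip: has_real_derivative_iff_has_vector_derivative intro: has_field_derivative_at_within)
    have \<phi>int: "set_integrable lborel {p..m - p} \<phi>"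
      by (rule set_integrable_subset[OF int[folded \<phi>_def]]) (use p in auto)
    have a\<phi>int: "((\<lambda>\<tau>. a * \<phi> \<tau>) has_integral a * (LBINT \<tau>:{p..m - p}. \<phi> \<tau>)) {p..m - p}"
      using set_borel_integral_eq_integral[OF \<phi>int] by (intro has_integral_mult_right) (simp add: has_integral_integral)
    have "a * (LBINT \<tau>:{p..m - p}. \<phi> \<tau>) \<le> F (m - p) - F p"
    proof (rule has_integral_le[OF a\<phi>int F'int])
      fix \<tau> assume "\<tau> \<in> {p..m - p}"
      then have "h \<tau> \<ge> 0" using min[of \<tau>] p by (simp add: h_def)
      then show "a * \<phi> \<tau> \<le> F' \<tau>" using \<alpha> by (simp add: F'_def)
    qed
    moreover have "F p \<ge> 0" using min[of p] p by (simp add: F_def h_def)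
    ultimately show ?thesis by (simp add: p_def)
  qed
  \<comment> \<open>Differentiability at \<open>m\<close> makes \<open>h (m - \<epsilon> n)\<close>
    of order \<open>\<epsilon> n\<close>, so \<open>F\<close> there is of order
    \<open>\<epsilon> n powr (1 - \<alpha>)\<close>, with a positive exponent.\<close>
  have F_lim: "(\<lambda>n. F (m - \<epsilon> n)) \<longlonglongrightarrow> 0"
  proof -
    have "((\<lambda>d. (x (m + d) - x m) / d) \<longlongrightarrow> deriv x m) (at 0)"
      using DERIV[OF m] by (simp add: DERIV_def)
    moreover have "filterlim (\<lambda>n. - \<epsilon> n) (at 0) sequentially"
      using \<epsilon> \<epsilon>_lim tendsto_minus[OF \<epsilon>_lim] by (auto simp: filterlim_at less_imp_neq[symmetric] intro!: always_eventually)
    ultimately have "(\<lambda>n. (x (m + - \<epsilon> n) - x m) / - \<epsilon> n) \<longlonglongrightarrow> deriv x m"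
      by (rule filterlim_compose)
    moreover have "(\<lambda>n. \<epsilon> n powr (1 - \<alpha>)) \<longlonglongrightarrow> 0 powr (1 - \<alpha>)"
      using \<epsilon> \<alpha> by (intro tendsto_powr' \<epsilon>_lim tendsto_const) (auto intro!: always_eventually simp: less_imp_le)
    ultimately have "(\<lambda>n. - a * (\<epsilon> n powr (1 - \<alpha>) * ((x (m + - \<epsilon> n) - x m) / - \<epsilon> n))) \<longlonglongrightarrow> - a * (0 powr (1 - \<alpha>) * deriv x m)"
      by (intro tendsto_mult tendsto_const)
    moreover have "- a * (\<epsilon> n powr (1 - \<alpha>) * ((x (m + - \<epsilon> n) - x m) / - \<epsilon> n)) = F (m - \<epsilon> n)" for n
      using \<epsilon>[of n] by (simp add: F_def h_def powr_diff powr_minus field_simps)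
    ultimately show ?thesis by simp
  qed
  \<comment> \<open>The truncated intervals increase to the open interval; with the integrability
    assumption \<open>int\<close> their integrals converge to the full one.\<close>
  have "(\<Union>n. {\<epsilon> n..m - \<epsilon> n}) = {0<..<m}"
  proof (intro equalityI subsetI)
    fix s assume s: "s \<in> {0<..<m}"
    then have "eventually (\<lambda>n. \<epsilon> n < min s (m - s)) sequentially"
      by (intro order_tendstoD[OF \<epsilon>_lim]) auto
    then obtain n where "\<epsilon> n < min s (m - s)" by (auto simp: eventually_sequentially)
    then show "s \<in> (\<Union>n. {\<epsilon> n..m - \<epsilon> n})" by (auto intro!: exI[of _ n])
  next
    fix s assume "s \<in> (\<Union>n. {\<epsilon> n..m - \<epsilon> n})"
    then obtain n where "\<epsilon> n \<le> s" "s \<le> m - \<epsilon> n" by auto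
    then show "s \<in> {0<..<m}" using \<epsilon>[of n] by auto
  qed
  moreover have "incseq (\<lambda>n. {\<epsilon> n..m - \<epsilon> n})"
  proof (rule incseq_SucI)
    fix n
    have "\<epsilon> (Suc n) \<le> \<epsilon> n" using m unfolding \<epsilon>_def by (intro divide_left_mono) auto
    then show "{\<epsilon> n..m - \<epsilon> n} \<subseteq> {\<epsilon> (Suc n)..m - \<epsilon> (Suc n)}" by auto
  qed
  ultimately have "(\<lambda>n. LBINT \<tau>:{\<epsilon> n..m - \<epsilon> n}. \<phi> \<tau>) \<longlonglongrightarrow> (LBINT \<tau>:{0<..<m}. \<phi> \<tau>)"
    using set_integral_cont_up[of "\<lambda>n. {\<epsilon> n..m - \<epsilon> n}" lborel \<phi>] int by (simp add: \<phi>_def)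
  then have "(\<lambda>n. a * (LBINT \<tau>:{\<epsilon> n..m - \<epsilon> n}. \<phi> \<tau>)) \<longlonglongrightarrow> a * (LBINT \<tau>:{0<..<m}. \<phi> \<tau>)"
    by (intro tendsto_intros)
  from LIMSEQ_le[OF this F_lim] show ?thesis using le by (auto simp: \<phi>_def)
qed

text \<open>The sign is read off the solution: \<open>x 0 * x t\<close> is \<open>x 0 * x 0\<close>
  times the Mittag-Leffler value, hence the hypothesis \<open>x 0 \<noteq> 0\<close>. The result
  removes the absolute value when \<open>e1\<close> is taken out of the square root in the
  equal-eigenvalue case.\<close>

lemma mittag_leffler_nonneg:
  assumes x0: "x 0 \<noteq> 0" and t: "t > 0"
  shows "0 \<le> mittag_leffler \<alpha> (l * t powr \<alpha>)"
proof (cases "l \<ge> 0")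
  case True
  have "summable (\<lambda>k. (l * t powr \<alpha>) ^ k / Gamma (\<alpha> * real k + 1))"
    using \<alpha> by (intro summable_mittag_leffler2) auto
  moreover have "Gamma (\<alpha> * real k + 1) > 0" for k
    using \<alpha> by (intro Gamma_real_pos) (auto intro: add_nonneg_pos)
  ultimately show ?thesis unfolding mittag_leffler_def
    using True by (intro suminf_nonneg) (auto simp: less_imp_le)
next
  case False
  have "0 \<le> x 0 * x t"
  proof (rule ccontr)
    assume neg: "\<not> 0 \<le> x 0 * x t"
    have "continuous_on {0..t} (\<lambda>s. x 0 * x s)"
      by (intro continuous_intros continuous_on_subset[OF cont]) auto
    \<comment> \<open>A minimum over \<open>{0..t}\<close> attained at \<open>m\<close> is also one
      over \<open>{0..m}\<close>; \<open>m\<close> is not 0 because the value there is a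
      square.\<close>
    then obtain m where m: "m \<in> {0..t}" and le: "\<And>s. s \<in> {0..t} \<Longrightarrow> x 0 * x m \<le> x 0 * x s"
      using continuous_attains_inf[of "{0..t}" "\<lambda>s. x 0 * x s"] t by auto
    have xm: "x 0 * x m < 0" using le[of t] t neg by auto
    have "m > 0" using m xm by (cases "m = 0") (auto simp: mult_less_0_iff)
    have G: "Gamma (1 - \<alpha>) > 0" using \<alpha> by (intro Gamma_real_pos) auto
    define C where "C = (LBINT \<tau>:{0<..<m}. (m - \<tau>) powr (- \<alpha>) * deriv x \<tau>)"
    have "x 0 * C = Gamma (1 - \<alpha>) * (l * (x 0 * x m))"
      using caputo[OF \<open>m > 0\<close>] G by (simp add: caputo_deriv_def C_def field_simps)
    moreover have "l * (x 0 * x m) > 0" using False xm by (intro mult_neg_neg) auto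
    ultimately have "x 0 * C > 0" using G by (simp only: mult_pos_pos)
    moreover have "x 0 * C \<le> 0"
    proof (cases "set_integrable lborel {0<..<m} (\<lambda>\<tau>. (m - \<tau>) powr (- \<alpha>) * deriv x \<tau>)")
      case True
      then show ?thesis
        unfolding C_def using \<open>m > 0\<close> m le by (intro caputo_integral_nonpos_at_min) auto
    next
      \<comment> \<open>the Lebesgue integral of a non-integrable function is \<open>0\<close> by convention\<close>
      case False
      then show ?thesis
        by (simp add: C_def set_lebesgue_integral_def set_integrable_def not_integrable_integral_eq)
    qed
    ultimately show False by simp
  qed
  then have "0 \<le> (x 0 * x 0) * mittag_leffler \<alpha> (l * t powr \<alpha>)"
    using eq_mittag_leffler[OF t] by (simp add: mult.assoc)
  moreover have "x 0 * x 0 > 0" using x0 by (simp flip: power2_eq_square)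
  ultimately show ?thesis by (simp add: zero_le_mult_iff)
qed

section \<open>First and second derivatives of an eigenfunction\<close>

lemma deriv_eq:
  assumes "t > 0"
  shows "deriv x t = x 0 * (l * t powr (\<alpha> - 1) * mittag_leffler2 \<alpha> \<alpha> (l * t powr \<alpha>))"
proof (rule DERIV_imp_deriv)
  have "((\<lambda>t. x 0 * mittag_leffler \<alpha> (l * t powr \<alpha>)) has_field_derivative
      x 0 * (l * t powr (\<alpha> - 1) * mittag_leffler2 \<alpha> \<alpha> (l * t powr \<alpha>))) (at t)"
    using \<alpha> assms by (intro DERIV_cmult has_field_derivative_mittag_leffler_powr)
  then show "(x has_field_derivative x 0 * (l * t powr (\<alpha> - 1) * mittag_leffler2 \<alpha> \<alpha> (l * t powr \<alpha>))) (at t)"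
    by (rule has_field_derivative_transform_within_open[of _ _ _ "{0<..}"])
      (use assms eq_mittag_leffler in auto)
qed

text \<open>Since \<open>deriv x\<close> agrees with \<open>x 0 * g\<close> on an open set, it
  inherits differentiability. Expressing the result by \<open>deriv g\<close> lets \<open>u1\<close>
  appear in the curvature.\<close>

lemma deriv_has_field_derivative:
  assumes g: "g = (\<lambda>t. l * t powr (\<alpha> - 1) * mittag_leffler2 \<alpha> \<alpha> (l * t powr \<alpha>))" and t: "t > 0"
  shows "(deriv x has_field_derivative x 0 * deriv g t) (at t)"
proof -
  have "g differentiable (at t)"
    unfolding g using \<alpha> t by (intro mittag_leffler2_powr_differentiable)
  then have "((\<lambda>t. x 0 * g t) has_field_derivative x 0 * deriv g t) (at t)"
    by (intro DERIV_cmult) (simp add: DERIV_deriv_iff_real_differentiable)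
  then show ?thesis
    by (rule has_field_derivative_transform_within_open[of _ _ _ "{0<..}"])
      (use t deriv_eq g in auto)
qed

end

section \<open>Geometry of the planar solution curves\<close>

lemma diag2_mult_vector: "diag2 a b *v v = vector [a * v $ 1, b * v $ 2]"
  by (simp add: vec_eq_iff forall_2 matrix_vector_mult_def diag2_def sum_2)

text \<open>Coordinate projection is bounded linear, so it carries derivatives and integrability
  from the vector solution to its component; \<open>A\<close> says that row \<open>i\<close> acts as
  the scalar \<open>l\<close>.\<close>

lemma caputo_solution_component:
  assumes X: "caputo_solution \<alpha> A X0 X" and \<alpha>: "0 < \<alpha>" "\<alpha> < 1"
    and A: "\<And>v. (A *v v) $ i = l * v $ i"
  shows "caputo_eigenfunction \<alpha> l (\<lambda>s. X s $ i)"
proof -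
  have vd: "((\<lambda>s. X s $ i) has_field_derivative vector_derivative X (at t) $ i) (at t)" if "t > 0" for t
  proof -
    have "(X has_vector_derivative vector_derivative X (at t)) (at t)"
      using X that by (simp add: caputo_solution_def vector_derivative_works)
    then have "((\<lambda>s. X s $ i) has_vector_derivative vector_derivative X (at t) $ i) (at t)"
      by (rule bounded_linear.has_vector_derivative[OF bounded_linear_vec_nth])
    then show ?thesis by (simp add: has_real_derivative_iff_has_vector_derivative)
  qed
  then have d: "deriv (\<lambda>s. X s $ i) t = vector_derivative X (at t) $ i" if "t > 0" for t
    using that DERIV_imp_deriv by blast
  show ?thesis
  proof
    show "continuous_on {0..} (\<lambda>s. X s $ i)"
      using X by (auto simp: caputo_solution_def intro!: continuous_intros)
    show "(\<lambda>s. X s $ i) differentiable (at t)" if "t > 0" for t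
      using vd[OF that] by (auto simp: real_differentiable_def)
    have "continuous_on {0<..} (\<lambda>t. vector_derivative X (at t) $ i)"
      using X by (auto simp: caputo_solution_def intro!: continuous_intros)
    then show "continuous_on {0<..} (deriv (\<lambda>s. X s $ i))"
      by (rule continuous_on_eq) (simp add: d)
    obtain \<delta> where \<delta>: "\<delta> > 0" "set_integrable lborel {0<..<\<delta>} (\<lambda>t. vector_derivative X (at t))"
      using X by (auto simp: caputo_solution_def)
    have "integrable lborel (\<lambda>t. (indicator {0<..<\<delta>} t *\<^sub>R vector_derivative X (at t)) $ i)"
      using \<delta>(2) unfolding set_integrable_def
      by (rule integrable_bounded_linear[OF bounded_linear_vec_nth])
    \<comment> \<open>\<open>d\<close> identifies the derivatives only for positive times; elsewhere
      the indicator makes both sides 0.\<close>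
    also have "(\<lambda>t. (indicator {0<..<\<delta>} t *\<^sub>R vector_derivative X (at t)) $ i) =
        (\<lambda>t. indicator {0<..<\<delta>} t *\<^sub>R deriv (\<lambda>s. X s $ i) t)"
      using d by (auto simp: fun_eq_iff indicator_def)
    finally show "\<exists>\<delta>>0. set_integrable lborel {0<..<\<delta>} (deriv (\<lambda>s. X s $ i))"
      using \<delta>(1) by (auto simp: set_integrable_def)
    show "caputo_deriv \<alpha> (\<lambda>s. X s $ i) t = l * X t $ i" if "t > 0" for t
    proof -
      have "(\<chi> i. caputo_deriv \<alpha> (\<lambda>s. X s $ i) t) = A *v X t"
        using X that by (simp add: caputo_solution_def)
      then show ?thesis by (metis (lifting) A vec_lambda_beta)
    qed
  qed (use \<alpha> in auto)
qed

theorem mainTheorem3: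
  fixes \<alpha> l1 l2 c1 c2 t1 e1 e2 :: real
    and X Y :: "real \<Rightarrow> real ^ 2"
    and g1 g2 u1 \<nu>1 \<nu>2 \<kappa>1 \<kappa>2 :: "real \<Rightarrow> real"
    and T1 T2 N1 N2 :: "real \<Rightarrow> real ^ 2"
  assumes "0 < \<alpha>" and "\<alpha> < 1" and "0 < t1"
    and "caputo_solution \<alpha> (diag2 l1 l2) (vector [c1, c2]) X"
    and "caputo_solution \<alpha> (diag2 l1 l2) (X t1) Y"
    and "\<nu>1 = curve_speed X" and "T1 = unit_tangent X"
    and "N1 = unit_normal X" and "\<kappa>1 = curvature X"
    and "\<nu>2 = curve_speed Y" and "T2 = unit_tangent Y"
    and "N2 = unit_normal Y" and "\<kappa>2 = curvature Y"
    and "g1 = (\<lambda>t. l1 * t powr (\<alpha> - 1) * mittag_leffler2 \<alpha> \<alpha> (l1 * t powr \<alpha>))"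
    and "g2 = (\<lambda>t. l2 * t powr (\<alpha> - 1) * mittag_leffler2 \<alpha> \<alpha> (l2 * t powr \<alpha>))"
    and "e1 = mittag_leffler \<alpha> (l1 * t1 powr \<alpha>)"
    and "e2 = mittag_leffler \<alpha> (l2 * t1 powr \<alpha>)"
    and "u1 = (\<lambda>t. g1 t * deriv g2 t - g2 t * deriv g1 t)"
  shows "twice_differentiable_curve X \<and> twice_differentiable_curve Y \<and>
    (\<forall>t>0. g1 differentiable (at t) \<and> g2 differentiable (at t)) \<and>
    (l1 \<noteq> l2 \<longrightarrow>
      (\<forall>t>0. \<nu>1 t = sqrt (c1\<^sup>2 * (g1 t)\<^sup>2 + c2\<^sup>2 * (g2 t)\<^sup>2) \<and>
             \<nu>2 t = sqrt (c1\<^sup>2 * e1\<^sup>2 * (g1 t)\<^sup>2 + c2\<^sup>2 * e2\<^sup>2 * (g2 t)\<^sup>2)) \<and>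
      (\<forall>t>0. \<nu>1 t \<noteq> 0 \<and> \<nu>2 t \<noteq> 0 \<longrightarrow>
         \<kappa>1 t = \<bar>c1 * c2 * u1 t / \<nu>1 t ^ 3\<bar> \<and>
         \<kappa>2 t = \<bar>c1 * c2 * e1 * e2 * u1 t / \<nu>2 t ^ 3\<bar> \<and>
         \<kappa>2 t = \<bar>e1 * e2 * \<nu>1 t ^ 3 / \<nu>2 t ^ 3\<bar> * \<kappa>1 t \<and>
         T1 t = (1 / \<nu>1 t) *\<^sub>R vector [c1 * g1 t, c2 * g2 t] \<and>
         T2 t = (1 / \<nu>2 t) *\<^sub>R vector [c1 * e1 * g1 t, c2 * e2 * g2 t] \<and>
         T2 t = (\<nu>1 t / \<nu>2 t) *\<^sub>R (diag2 e1 e2 *v T1 t) \<and>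
         N1 t = (1 / \<nu>1 t) *\<^sub>R vector [- c2 * g2 t, c1 * g1 t] \<and>
         N2 t = (1 / \<nu>2 t) *\<^sub>R vector [- c2 * e2 * g2 t, c1 * e1 * g1 t] \<and>
         N2 t = (\<nu>1 t / \<nu>2 t) *\<^sub>R (diag2 e2 e1 *v N1 t))) \<and>
    (l1 = l2 \<longrightarrow>
      (\<forall>t>0. \<nu>2 t = mittag_leffler \<alpha> (l1 * t1 powr \<alpha>) * \<nu>1 t) \<and>
      (\<forall>t>0. \<nu>1 t \<noteq> 0 \<and> \<nu>2 t \<noteq> 0 \<longrightarrow>
         T2 t = T1 t \<and> N2 t = N1 t \<and> \<kappa>2 t = \<kappa>1 t \<and> \<kappa>1 t = 0))"
proof -
  note \<alpha> = \<open>0 < \<alpha>\<close> \<open>\<alpha> < 1\<close> and X = \<open>caputo_solution \<alpha> (diag2 l1 l2) (vector [c1, c2]) X\<close>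
    and Y = \<open>caputo_solution \<alpha> (diag2 l1 l2) (X t1) Y\<close>
  note g1 = \<open>g1 = _\<close> and g2 = \<open>g2 = _\<close> and e1 = \<open>e1 = _\<close> and e2 = \<open>e2 = _\<close>
  interpret X1: caputo_eigenfunction \<alpha> l1 "\<lambda>s. X s $ 1"
    by (rule caputo_solution_component[OF X \<alpha>]) (simp add: diag2_mult_vector)
  interpret X2: caputo_eigenfunction \<alpha> l2 "\<lambda>s. X s $ 2"
    by (rule caputo_solution_component[OF X \<alpha>]) (simp add: diag2_mult_vector)
  interpret Y1: caputo_eigenfunction \<alpha> l1 "\<lambda>s. Y s $ 1"
    by (rule caputo_solution_component[OF Y \<alpha>]) (simp add: diag2_mult_vector)
  interpret Y2: caputo_eigenfunction \<alpha> l2 "\<lambda>s. Y s $ 2"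
    by (rule caputo_solution_component[OF Y \<alpha>]) (simp add: diag2_mult_vector)
  have X0: "X 0 $ 1 = c1" "X 0 $ 2 = c2"
    using X by (auto simp: caputo_solution_def)
  \<comment> \<open>Restarting at \<open>X t1\<close> only rescales the initial data by
    \<open>e1\<close> and \<open>e2\<close>, so every formula for \<open>Y\<close> is that for
    \<open>X\<close> with \<open>c1 * e1\<close> and \<open>c2 * e2\<close>.\<close>
  have Y0: "Y 0 $ 1 = c1 * e1" "Y 0 $ 2 = c2 * e2"
    using Y X1.eq_mittag_leffler[OF \<open>0 < t1\<close>] X2.eq_mittag_leffler[OF \<open>0 < t1\<close>] X0
      e1 e2 by (auto simp: caputo_solution_def)
  have D: "deriv (\<lambda>s. X s $ 1) t = c1 * g1 t" "deriv (\<lambda>s. X s $ 2) t = c2 * g2 t"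
    "deriv (\<lambda>s. Y s $ 1) t = c1 * e1 * g1 t" "deriv (\<lambda>s. Y s $ 2) t = c2 * e2 * g2 t" if "t > 0" for t
    using X1.deriv_eq[OF that] X2.deriv_eq[OF that] Y1.deriv_eq[OF that] Y2.deriv_eq[OF that]
    by (simp_all add: X0 Y0 g1 g2)
  have DD: "(deriv (\<lambda>s. X s $ 1) has_field_derivative c1 * deriv g1 t) (at t)"
    "(deriv (\<lambda>s. X s $ 2) has_field_derivative c2 * deriv g2 t) (at t)"
    "(deriv (\<lambda>s. Y s $ 1) has_field_derivative c1 * e1 * deriv g1 t) (at t)"
    "(deriv (\<lambda>s. Y s $ 2) has_field_derivative c2 * e2 * deriv g2 t) (at t)" if "t > 0" for t
    using X1.deriv_has_field_derivative[OF g1 that] X2.deriv_has_field_derivative[OF g2 that]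
      Y1.deriv_has_field_derivative[OF g1 that] Y2.deriv_has_field_derivative[OF g2 that]
    by (simp_all add: X0 Y0)
  note D2 = DD[THEN DERIV_imp_deriv]
  have twice: "twice_differentiable_curve X" "twice_differentiable_curve Y"
    unfolding twice_differentiable_curve_def forall_2
    using X1.diff X2.diff Y1.diff Y2.diff
      DD[THEN has_field_derivative_imp_has_derivative, THEN differentiableI] by simp_all
  have g_diff: "\<forall>t>0. g1 differentiable (at t) \<and> g2 differentiable (at t)"
    unfolding g1 g2 using \<alpha> by (auto intro: mittag_leffler2_powr_differentiable)
  have \<nu>1: "\<nu>1 t = sqrt ((c1 * g1 t)\<^sup>2 + (c2 * g2 t)\<^sup>2)"
    and \<nu>2: "\<nu>2 t = sqrt ((c1 * e1 * g1 t)\<^sup>2 + (c2 * e2 * g2 t)\<^sup>2)" if "t > 0" for t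
    using D[OF that] by (simp_all add: \<open>\<nu>1 = _\<close> \<open>\<nu>2 = _\<close> curve_speed_def)
  \<comment> \<open>Nonnegative speeds let the cubed denominators move inside the absolute values
    below.\<close>
  have pos: "\<nu>1 t \<ge> 0" "\<nu>2 t \<ge> 0" for t
    by (simp_all add: \<open>\<nu>1 = _\<close> \<open>\<nu>2 = _\<close> curve_speed_def)
  have \<kappa>1: "\<kappa>1 t = \<bar>c1 * c2 * u1 t / \<nu>1 t ^ 3\<bar>"
    and \<kappa>2: "\<kappa>2 t = \<bar>c1 * c2 * e1 * e2 * u1 t / \<nu>2 t ^ 3\<bar>" if "t > 0" for t
  proof -
    have "\<kappa>1 t = \<bar>c1 * g1 t * (c2 * deriv g2 t) - c2 * g2 t * (c1 * deriv g1 t)\<bar> / \<nu>1 t ^ 3"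
      using D[OF that] D2[OF that] by (simp add: \<open>\<kappa>1 = _\<close> \<open>\<nu>1 = _\<close> curvature_def)
    also have "c1 * g1 t * (c2 * deriv g2 t) - c2 * g2 t * (c1 * deriv g1 t) = c1 * c2 * u1 t"
      by (simp add: \<open>u1 = _\<close> algebra_simps)
    finally show "\<kappa>1 t = \<bar>c1 * c2 * u1 t / \<nu>1 t ^ 3\<bar>" using pos[of t] by simp
    have "\<kappa>2 t = \<bar>c1 * e1 * g1 t * (c2 * e2 * deriv g2 t) - c2 * e2 * g2 t * (c1 * e1 * deriv g1 t)\<bar> / \<nu>2 t ^ 3"
      using D[OF that] D2[OF that] by (simp add: \<open>\<kappa>2 = _\<close> \<open>\<nu>2 = _\<close> curvature_def)
    also have "c1 * e1 * g1 t * (c2 * e2 * deriv g2 t) - c2 * e2 * g2 t * (c1 * e1 * deriv g1 t) = c1 * c2 * e1 * e2 * u1 t"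
      by (simp add: \<open>u1 = _\<close> algebra_simps)
    finally show "\<kappa>2 t = \<bar>c1 * c2 * e1 * e2 * u1 t / \<nu>2 t ^ 3\<bar>" using pos[of t] by simp
  qed
  have T: "T1 t = (1 / \<nu>1 t) *\<^sub>R vector [c1 * g1 t, c2 * g2 t]"
    "T2 t = (1 / \<nu>2 t) *\<^sub>R vector [c1 * e1 * g1 t, c2 * e2 * g2 t]" if "t > 0" for t
    using D[OF that] by (simp_all add: \<open>T1 = _\<close> \<open>T2 = _\<close> \<open>\<nu>1 = _\<close> \<open>\<nu>2 = _\<close> unit_tangent_def)
  have N: "N1 t = (1 / \<nu>1 t) *\<^sub>R vector [- c2 * g2 t, c1 * g1 t]"
    "N2 t = (1 / \<nu>2 t) *\<^sub>R vector [- c2 * e2 * g2 t, c1 * e1 * g1 t]" if "t > 0" for t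
    using D[OF that] by (simp_all add: \<open>N1 = _\<close> \<open>N2 = _\<close> \<open>\<nu>1 = _\<close> \<open>\<nu>2 = _\<close> unit_normal_def)
  have \<kappa>21: "\<kappa>2 t = \<bar>e1 * e2 * \<nu>1 t ^ 3 / \<nu>2 t ^ 3\<bar> * \<kappa>1 t" if "t > 0" "\<nu>1 t \<noteq> 0" for t
    using that by (simp add: \<kappa>1 \<kappa>2 abs_mult)
  have T21: "T2 t = (\<nu>1 t / \<nu>2 t) *\<^sub>R (diag2 e1 e2 *v T1 t)"
    and N21: "N2 t = (\<nu>1 t / \<nu>2 t) *\<^sub>R (diag2 e2 e1 *v N1 t)" if "t > 0" "\<nu>1 t \<noteq> 0" for t
    using that by (simp_all add: T N vec_eq_iff forall_2 diag2_mult_vector)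
  have distinct: "\<nu>1 t = sqrt (c1\<^sup>2 * (g1 t)\<^sup>2 + c2\<^sup>2 * (g2 t)\<^sup>2)"
    "\<nu>2 t = sqrt (c1\<^sup>2 * e1\<^sup>2 * (g1 t)\<^sup>2 + c2\<^sup>2 * e2\<^sup>2 * (g2 t)\<^sup>2)" if "t > 0" for t
    using that by (simp_all add: \<nu>1 \<nu>2 power_mult_distrib)
  have \<nu>2_eq: "\<nu>2 t = e1 * \<nu>1 t" and g_eq: "g1 = g2" "e1 = e2"
    if "l1 = l2" "t > 0" for t
  proof -
    show eq: "g1 = g2" "e1 = e2"
      using that g1 g2 e1 e2 by simp_all
    show "\<nu>2 t = e1 * \<nu>1 t"
    \<comment> \<open>With both initial values zero, \<open>mittag_leffler_nonneg\<close> does not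
      apply, but both speeds vanish. Otherwise a component with nonzero initial value gives the sign
      of \<open>e1\<close>.\<close>
    proof (cases "c1 = 0 \<and> c2 = 0")
      case True
      then show ?thesis using that by (simp add: \<nu>1 \<nu>2)
    next
      case False
      then have "e1 \<ge> 0"
        using X1.mittag_leffler_nonneg[OF _ \<open>0 < t1\<close>] X2.mittag_leffler_nonneg[OF _ \<open>0 < t1\<close>]
          e1 that X0 by auto
      have "(c1 * e1 * g1 t)\<^sup>2 + (c2 * e1 * g1 t)\<^sup>2 = e1\<^sup>2 * ((c1 * g1 t)\<^sup>2 + (c2 * g1 t)\<^sup>2)"
        by (simp add: power_mult_distrib algebra_simps)
      then show ?thesis using that \<open>e1 \<ge> 0\<close> by (simp add: \<nu>1 \<nu>2 eq[symmetric] real_sqrt_mult)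
    qed
  qed
  have equal: "T2 t = T1 t \<and> N2 t = N1 t \<and> \<kappa>2 t = \<kappa>1 t \<and> \<kappa>1 t = 0"
    if l: "l1 = l2" and t: "t > 0" and nz: "\<nu>1 t \<noteq> 0" "\<nu>2 t \<noteq> 0" for t
  proof -
    \<comment> \<open>A nonzero \<open>\<nu>2 t\<close> forces \<open>e1 \<noteq> 0\<close>, so the
      common factor \<open>e1\<close> cancels from tangent and normal.\<close>
    have "e1 \<noteq> 0" using nz \<nu>2_eq[OF l t] by auto
    moreover have "u1 t = 0" using g_eq(1)[OF l t] by (simp add: \<open>u1 = _\<close>)
    ultimately show ?thesis using t \<nu>2_eq[OF l t] g_eq(2)[OF l t, symmetric]
      by (simp add: T N \<kappa>1 \<kappa>2 vec_eq_iff forall_2)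
  qed
  show ?thesis
    using twice g_diff distinct \<kappa>1 \<kappa>2 \<kappa>21 T T21 N N21 \<nu>2_eq equal e1 by simp
qed

end
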